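(* Let $\beta>0$, $\lambda_p,\lambda_k\in\mathbb R$, and let $s_1,\dots,s_n\in\{\pm1\}$ be a nonconstant sign pattern, $S_\pm=\{i:s_i=\pm1\}$, $n_\pm=|S_\pm|$. Let $K^*_{ij}=a_+$ for $i,j\in S_+$, $b_+$ for $i\in S_+,j\in S_-$, $b_-$ for $i\in S_-,j\in S_+$, $a_-$ for $i,j\in S_-$, where \[ a_+=\frac{e^{\beta\lambda_p}}{n_+e^{\beta\lambda_p}+n_-e^{-\beta\lambda_p}},\ b_+=\frac{e^{-\beta\lambda_p}}{n_+e^{\beta\lambda_p}+n_-e^{-\beta\lambda_p}},\ a_-=\frac{e^{\beta\lambda_p}}{n_-e^{\beta\lambda_p}+n_+e^{-\beta\lambda_p}},\ b_-=\frac{e^{-\beta\lambda_p}}{n_-e^{\beta\lambda_p}+n_+e^{-\beta\lambda_p}}, \] let $\gamma_+=\lambda_p(n_+a_+-n_-b_+)$, $\gamma_-=\lambda_p(n_-a_--n_+b_-)$, $\gamma_i=\gamma_\pm$ for $i\in S_\pm$, and define $L_k:\mathbb R^n\to\mathbb R^n$ by $(L_kz)_i=-\gamma_iz_i+\lambda_k\sum_{j=1}^nK^*_{ij}z_j$. Let $V_\pm=\{z: z_i=0\text{ for }i\in S_\mp,\ \sum_{i\in S_\pm}z_i=0\}$ and $V_{\mathrm{mean}}=\{z: z\text{ constant on }S_+\text{ and on }S_-\}$. Then: on $V_+$ the only eigenvalue of $L_k$ is $-\gamma_+$, with multiplicity $n_+-1$; on $V_-$ the only eigenvalue is $-\gamma_-$,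 with multiplicity $n_--1$; and on $V_{\mathrm{mean}}$ the eigenvalues of $L_k$ are exactly those of \[ B_k=\begin{pmatrix}\lambda_kn_+a_+-\gamma_+ & \lambda_kn_-b_+\\ \lambda_kn_+b_- & \lambda_kn_-a_--\gamma_-\end{pmatrix}. \]
   Context: $L_k$ is the modewise (transverse direction $e_k$, $k\ne p$) linearization of the symmetric self-attention dynamics at the sign-split pure-mode equilibrium $x_i^*=s_ie_p$, where $\lambda_p,\lambda_k$ are eigenvalues of the symmetric interaction matrix. The subspaces $V_+,V_-,V_{\mathrm{mean}}$ are $L_k$-invariant and $\mathbb R^n=V_+\oplus V_-\oplus V_{\mathrm{mean}}$. *)

theory Defs
  imports "HOL-Analysis.Analysis"
begin

text \<open>Signs s :: 'n => real with values in {1,-1}; S_plus = {i. s i = 1}, S_minus = {i. s i = -1}.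
  The linear map L_k is extended complex-linearly to complex^'n so that (possibly non-real)
  eigenvalues and algebraic multiplicities are meaningful.\<close>

definition nplus :: "('n::finite \<Rightarrow> real) \<Rightarrow> real" where
  "nplus s = real (card {i. s i = 1})"
definition nminus :: "('n::finite \<Rightarrow> real) \<Rightarrow> real" where
  "nminus s = real (card {i. s i = -1})"

definition aplus :: "real \<Rightarrow> real \<Rightarrow> ('n::finite \<Rightarrow> real) \<Rightarrow> real" where
  "aplus \<beta> lp s = exp (\<beta>*lp) / (nplus s * exp (\<beta>*lp) + nminus s * exp (-\<beta>*lp))"
definition bplus :: "real \<Rightarrow> real \<Rightarrow> ('n::finite \<Rightarrow> real) \<Rightarrow> real" where
  "bplus \<beta> lp s = exp (-\<beta>*lp) / (nplus s * exp (\<beta>*lp) + nminus s * exp (-\<beta>*lp))"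
definition aminus :: "real \<Rightarrow> real \<Rightarrow> ('n::finite \<Rightarrow> real) \<Rightarrow> real" where
  "aminus \<beta> lp s = exp (\<beta>*lp) / (nminus s * exp (\<beta>*lp) + nplus s * exp (-\<beta>*lp))"
definition bminus :: "real \<Rightarrow> real \<Rightarrow> ('n::finite \<Rightarrow> real) \<Rightarrow> real" where
  "bminus \<beta> lp s = exp (-\<beta>*lp) / (nminus s * exp (\<beta>*lp) + nplus s * exp (-\<beta>*lp))"

definition Kstar :: "real \<Rightarrow> real \<Rightarrow> ('n::finite \<Rightarrow> real) \<Rightarrow> 'n \<Rightarrow> 'n \<Rightarrow> real" where
  "Kstar \<beta> lp s i j =
     (if s i = 1 then (if s j = 1 then aplus \<beta> lp s else bplus \<beta> lp s)
      else (if s j = 1 then bminus \<beta> lp s else aminus \<beta> lp s))"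

definition gplus :: "real \<Rightarrow> real \<Rightarrow> ('n::finite \<Rightarrow> real) \<Rightarrow> real" where
  "gplus \<beta> lp s = lp * (nplus s * aplus \<beta> lp s - nminus s * bplus \<beta> lp s)"
definition gminus :: "real \<Rightarrow> real \<Rightarrow> ('n::finite \<Rightarrow> real) \<Rightarrow> real" where
  "gminus \<beta> lp s = lp * (nminus s * aminus \<beta> lp s - nplus s * bminus \<beta> lp s)"

definition gam :: "real \<Rightarrow> real \<Rightarrow> ('n::finite \<Rightarrow> real) \<Rightarrow> 'n \<Rightarrow> real" where
  "gam \<beta> lp s i = (if s i = 1 then gplus \<beta> lp s else gminus \<beta> lp s)"

definition Lk :: "real \<Rightarrow> real \<Rightarrow> real \<Rightarrow> ('n::finite \<Rightarrow> real) \<Rightarrow> complex^'n \<Rightarrow> complex^'n" where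
  "Lk \<beta> lp lk s z = (\<chi> i. - of_real (gam \<beta> lp s i) * z$i
       + of_real lk * (\<Sum>j\<in>UNIV. of_real (Kstar \<beta> lp s i j) * z$j))"

definition Vplus :: "('n::finite \<Rightarrow> real) \<Rightarrow> (complex^'n) set" where
  "Vplus s = {z. (\<forall>i. s i = -1 \<longrightarrow> z$i = 0) \<and> (\<Sum>i\<in>{i. s i = 1}. z$i) = 0}"
definition Vminus :: "('n::finite \<Rightarrow> real) \<Rightarrow> (complex^'n) set" where
  "Vminus s = {z. (\<forall>i. s i = 1 \<longrightarrow> z$i = 0) \<and> (\<Sum>i\<in>{i. s i = -1}. z$i) = 0}"
definition Vmean :: "('n::finite \<Rightarrow> real) \<Rightarrow> (complex^'n) set" where
  "Vmean s = {z. (\<forall>i j. s i = 1 \<and> s j = 1 \<longrightarrow> z$i = z$j) \<and>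
                  (\<forall>i j. s i = -1 \<and> s j = -1 \<longrightarrow> z$i = z$j)}"

definition Bk :: "real \<Rightarrow> real \<Rightarrow> real \<Rightarrow> ('n::finite \<Rightarrow> real) \<Rightarrow> complex^2^2" where
  "Bk \<beta> lp lk s = (\<chi> r c. of_real
     (if r = 1 then (if c = 1 then lk * nplus s * aplus \<beta> lp s - gplus \<beta> lp s
                     else lk * nminus s * bplus \<beta> lp s)
      else (if c = 1 then lk * nplus s * bminus \<beta> lp s
            else lk * nminus s * aminus \<beta> lp s - gminus \<beta> lp s)))"

text \<open>Eigenvalue of a linear map f restricted to a subspace V, and its algebraic
  multiplicity = (complex) dimension of the generalized eigenspace inside V.\<close>
definition eigenvalue_on :: "('a::field^'n \<Rightarrow> 'a^'n) \<Rightarrow> ('a^'n) set \<Rightarrow> 'a \<Rightarrow> bool" where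
  "eigenvalue_on f V \<mu> \<longleftrightarrow> (\<exists>z\<in>V. z \<noteq> 0 \<and> f z = \<mu> *s z)"

definition gen_eigenspace_on :: "('a::field^'n \<Rightarrow> 'a^'n) \<Rightarrow> ('a^'n) set \<Rightarrow> 'a \<Rightarrow> ('a^'n) set" where
  "gen_eigenspace_on f V \<mu> = {z\<in>V. \<exists>m. ((\<lambda>w. f w - \<mu> *s w) ^^ m) z = 0}"

definition alg_mult_on :: "('a::field^'n \<Rightarrow> 'a^'n) \<Rightarrow> ('a^'n) set \<Rightarrow> 'a \<Rightarrow> nat" where
  "alg_mult_on f V \<mu> = vec.dim (gen_eigenspace_on f V \<mu>)"

end

theory Submission
  imports Defs
begin

text \<open>On a vector supported in one sign class with zero sum, the coupling term
  \<open>\<Sum>\<^sub>j K\<^sup>*\<^sub>i\<^sub>j z\<^sub>j\<close> vanishes, because \<open>K\<^sup>*\<^sub>i\<^sub>j\<close> depends on \<open>j\<close> only through \<open>s\<^sub>j\<close>;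
  hence \<open>L\<^sub>k\<close> is the scalar \<open>-\<gamma>\<^sub>\<plusminus>\<close> on \<open>V\<^sub>\<plusminus>\<close>, and \<open>dim V\<^sub>\<plusminus> = n\<^sub>\<plusminus> - 1\<close>.
  The map \<open>(w\<^sub>1, w\<^sub>2) \<mapsto> z\<close> with \<open>z\<^sub>i = w\<^sub>1\<close> on \<open>S\<^sub>+\<close> and \<open>z\<^sub>i = w\<^sub>2\<close> on \<open>S\<^sub>-\<close> is a linear
  bijection \<open>\<complex>\<^sup>2 \<rightarrow> V\<^sub>m\<^sub>e\<^sub>a\<^sub>n\<close> intertwining \<open>B\<^sub>k\<close> with \<open>L\<^sub>k\<close>, so it carries eigenvectors and
  generalized eigenspaces of \<open>B\<^sub>k\<close> onto those of \<open>L\<^sub>k\<close> on \<open>V\<^sub>m\<^sub>e\<^sub>a\<^sub>n\<close>.\<close>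

definition coordinate_subspace :: "'n::finite set \<Rightarrow> ('a::field^'n) set" where
  "coordinate_subspace P = {z. \<forall>i. i \<notin> P \<longrightarrow> z$i = 0}"

definition zero_sum_subspace :: "'n::finite set \<Rightarrow> ('a::field^'n) set" where
  "zero_sum_subspace P = {z \<in> coordinate_subspace P. (\<Sum>i\<in>P. z$i) = 0}"

lemma subspace_coordinate_subspace: "vec.subspace (coordinate_subspace P)"
  unfolding vec.subspace_def coordinate_subspace_def by auto

lemma subspace_zero_sum_subspace: "vec.subspace (zero_sum_subspace P)"
  unfolding vec.subspace_def zero_sum_subspace_def coordinate_subspace_def
  by (auto simp: sum.distrib sum_distrib_left[symmetric])

lemma dim_coordinate_subspace: "vec.dim (coordinate_subspace P :: ('a::field^'n::finite) set) = card P"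
proof -
  define B :: "('a^'n) set" where "B = (\<lambda>j. axis j 1) ` P"
  have "card B = card P"
    unfolding B_def by (rule card_image) (auto simp: inj_on_def axis_eq_axis)
  moreover have "B \<subseteq> coordinate_subspace P"
    by (auto simp: B_def coordinate_subspace_def axis_def)
  moreover have "coordinate_subspace P \<subseteq> vec.span B"
  proof
    fix z :: "'a^'n" assume "z \<in> coordinate_subspace P"
    then have "z = (\<Sum>j\<in>P. z$j *s axis j 1)"
      by (subst basis_expansion[symmetric, of z], intro sum.mono_neutral_right)
         (auto simp: coordinate_subspace_def)
    also have "\<dots> \<in> vec.span B"
      by (intro vec.span_sum vec.span_scale vec.span_base) (auto simp: B_def)
    finally show "z \<in> vec.span B" .
  qed
  moreover have "vec.independent B"
    by (rule vec.independent_mono[OF independent_cart_basis]) (auto simp: B_def cart_basis_def)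
  ultimately show ?thesis
    using vec.basis_card_eq_dim by metis
qed

lemma dim_zero_sum_subspace:
  assumes "P \<noteq> {}"
  shows "vec.dim (zero_sum_subspace P :: ('a::field^'n::finite) set) = card P - 1"
proof -
  obtain i0 where i0: "i0 \<in> P" using assms by auto
  define e :: "'a^'n" where "e = axis i0 1"
  define V :: "('a^'n) set" where "V = zero_sum_subspace P"
  have e_sum: "(\<Sum>i\<in>P. c * e$i) = c" for c
    using i0 by (simp add: e_def axis_def if_distrib[of "(*) c"] cong: if_cong)
  have "e \<notin> V"
    using e_sum[of 1] by (simp add: V_def zero_sum_subspace_def)
  then have "e \<notin> vec.span V"
    by (metis V_def subspace_zero_sum_subspace vec.span_eq_iff)
  then have "vec.dim (insert e V) = vec.dim V + 1"
    by (simp add: vec.dim_insert)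
  moreover have "vec.span (insert e V) = coordinate_subspace P"
  proof
    show "vec.span (insert e V) \<subseteq> coordinate_subspace P"
      using i0 by (intro vec.span_minimal subspace_coordinate_subspace)
        (auto simp: V_def zero_sum_subspace_def coordinate_subspace_def e_def axis_def)
  next
    show "coordinate_subspace P \<subseteq> vec.span (insert e V)"
    proof
      fix z :: "'a^'n" assume z: "z \<in> coordinate_subspace P"
      define c where "c = (\<Sum>i\<in>P. z$i)"
      have "z - c *s e \<in> V"
        using z i0 e_sum[of c]
        by (auto simp: V_def zero_sum_subspace_def coordinate_subspace_def c_def
            sum_subtractf e_def axis_def)
      then have "(z - c *s e) + c *s e \<in> vec.span (insert e V)"
        by (intro vec.span_add vec.span_scale vec.span_base) auto
      then show "z \<in> vec.span (insert e V)" by simp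
    qed
  qed
  then have "vec.dim (insert e V) = card P"
    by (metis vec.dim_span dim_coordinate_subspace)
  ultimately show ?thesis
    by (simp add: V_def)
qed

lemma eigenvalue_on_scalar_action:
  assumes "\<And>z. z \<in> V \<Longrightarrow> f z = c *s z" and "eigenvalue_on f V \<mu>"
  shows "\<mu> = (c::'a::field)"
proof -
  obtain z where z: "z \<in> V" "z \<noteq> 0" "f z = \<mu> *s z"
    using assms(2) unfolding eigenvalue_on_def by blast
  obtain i where "z$i \<noteq> 0"
    using z(2) by (metis vec_eq_iff zero_index)
  moreover have "c * z$i = \<mu> * z$i"
    using assms(1) z by (metis vector_smult_component)
  ultimately show ?thesis by simp
qed

lemma alg_mult_on_scalar_action:
  assumes "\<And>z. z \<in> V \<Longrightarrow> f z = c *s z"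
  shows "alg_mult_on f V c = vec.dim V"
proof -
  have "((\<lambda>w. f w - c *s w) ^^ 1) z = 0" if "z \<in> V" for z
    using assms that by simp
  then have "gen_eigenspace_on f V c = V"
    unfolding gen_eigenspace_on_def by blast
  then show ?thesis
    by (simp add: alg_mult_on_def)
qed

lemma funpow_shift_intertwining:
  fixes \<phi> :: "'a::field^'m \<Rightarrow> 'a^'n"
  assumes lin: "Vector_Spaces.linear (*s) (*s) \<phi>" and comm: "\<And>x. f (\<phi> x) = \<phi> (g x)"
  shows "((\<lambda>w. f w - \<mu> *s w) ^^ m) (\<phi> x) = \<phi> (((\<lambda>w. g w - \<mu> *s w) ^^ m) x)"
  by (induction m) (simp_all add: comm vec.linear_diff[OF lin] vec.linear_scale[OF lin])

lemma
  fixes \<phi> :: "'a::field^'m \<Rightarrow> 'a^'n"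
  assumes lin: "Vector_Spaces.linear (*s) (*s) \<phi>" and "inj \<phi>"
    and comm: "\<And>x. f (\<phi> x) = \<phi> (g x)"
  shows eigenvalue_on_range_intertwining:
      "eigenvalue_on f (range \<phi>) \<mu> \<longleftrightarrow> eigenvalue_on g UNIV \<mu>"
    and gen_eigenspace_on_range_intertwining:
      "gen_eigenspace_on f (range \<phi>) \<mu> = \<phi> ` gen_eigenspace_on g UNIV \<mu>"
proof -
  have eq_iff: "\<phi> x = \<phi> y \<longleftrightarrow> x = y" for x y
    using \<open>inj \<phi>\<close> by (meson injD)
  have zero_iff: "\<phi> x = 0 \<longleftrightarrow> x = 0" for x
    using eq_iff[of x 0] by (simp add: vec.linear_0[OF lin])
  have "f (\<phi> x) = \<mu> *s \<phi> x \<longleftrightarrow> g x = \<mu> *s x" for x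
    by (simp add: comm eq_iff flip: vec.linear_scale[OF lin])
  then show "eigenvalue_on f (range \<phi>) \<mu> \<longleftrightarrow> eigenvalue_on g UNIV \<mu>"
    unfolding eigenvalue_on_def by (auto simp: zero_iff)
  have "((\<lambda>w. f w - \<mu> *s w) ^^ m) (\<phi> x) = 0 \<longleftrightarrow> ((\<lambda>w. g w - \<mu> *s w) ^^ m) x = 0" for m x
    by (simp add: funpow_shift_intertwining[of \<phi> f g, OF lin comm] zero_iff)
  then show "gen_eigenspace_on f (range \<phi>) \<mu> = \<phi> ` gen_eigenspace_on g UNIV \<mu>"
    unfolding gen_eigenspace_on_def by auto
qed

lemma alg_mult_on_range_intertwining:
  fixes \<phi> :: "'a::field^'m \<Rightarrow> 'a^'n"
  assumes lin: "Vector_Spaces.linear (*s) (*s) \<phi>" and inj: "inj \<phi>"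
    and "\<And>x. f (\<phi> x) = \<phi> (g x)"
  shows "alg_mult_on f (range \<phi>) \<mu> = alg_mult_on g UNIV \<mu>"
  unfolding alg_mult_on_def gen_eigenspace_on_range_intertwining[of \<phi> f g, OF assms]
  by (rule vec.dim_image_eq[OF lin inj_on_subset[OF inj subset_UNIV]])

lemma Lk_zero_sum_sign_class:
  assumes "z \<in> zero_sum_subspace {j. s j = s i0}"
  shows "Lk \<beta> lp lk s z = - of_real (gam \<beta> lp s i0) *s z"
proof -
  let ?P = "{j. s j = s i0}"
  have outside: "z$j = 0" if "s j \<noteq> s i0" for j
    using assms that by (simp add: zero_sum_subspace_def coordinate_subspace_def)
  have "(\<Sum>j\<in>UNIV. of_real (Kstar \<beta> lp s i j) * z$j) = 0" for i
  proof -
    have "(\<Sum>j\<in>UNIV. of_real (Kstar \<beta> lp s i j) * z$j) = (\<Sum>j\<in>?P. of_real (Kstar \<beta> lp s i j) * z$j)"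
      by (rule sum.mono_neutral_right) (auto simp: outside)
    also have "\<dots> = of_real (Kstar \<beta> lp s i i0) * (\<Sum>j\<in>?P. z$j)"
      by (simp add: sum_distrib_left Kstar_def)
    finally show ?thesis
      using assms by (simp add: zero_sum_subspace_def)
  qed
  moreover have "of_real (gam \<beta> lp s i) * z$i = of_real (gam \<beta> lp s i0) * z$i" for i
    by (cases "s i = s i0") (simp_all add: gam_def outside)
  ultimately show ?thesis
    by (simp add: Lk_def vec_eq_iff)
qed

lemma
  assumes "\<forall>i. s i = 1 \<or> s i = -1"
  shows Vplus_eq_zero_sum_subspace: "Vplus s = zero_sum_subspace {i. s i = 1}"
    and Vminus_eq_zero_sum_subspace: "Vminus s = zero_sum_subspace {i. s i = -1}"
proof -
  have "s i = -1 \<longleftrightarrow> s i \<noteq> 1" for i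
    using assms by force
  then show "Vplus s = zero_sum_subspace {i. s i = 1}"
    "Vminus s = zero_sum_subspace {i. s i = -1}"
    by (auto simp: Vplus_def Vminus_def zero_sum_subspace_def coordinate_subspace_def)
qed

lemma
  assumes "\<forall>i. s i = 1 \<or> s i = -1" and "s ip = 1"
  shows Lk_Vplus: "z \<in> Vplus s \<Longrightarrow> Lk \<beta> lp lk s z = - of_real (gplus \<beta> lp s) *s z"
    and dim_Vplus: "vec.dim (Vplus s) = card {i. s i = 1} - 1"
proof -
  show "z \<in> Vplus s \<Longrightarrow> Lk \<beta> lp lk s z = - of_real (gplus \<beta> lp s) *s z"
    using Lk_zero_sum_sign_class[of z s ip] assms
    by (simp add: Vplus_eq_zero_sum_subspace gam_def)
  have "{i. s i = 1} \<noteq> {}"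
    using assms(2) by blast
  then show "vec.dim (Vplus s) = card {i. s i = 1} - 1"
    by (simp add: Vplus_eq_zero_sum_subspace[OF assms(1)] dim_zero_sum_subspace)
qed

lemma
  assumes "\<forall>i. s i = 1 \<or> s i = -1" and "s im = -1"
  shows Lk_Vminus: "z \<in> Vminus s \<Longrightarrow> Lk \<beta> lp lk s z = - of_real (gminus \<beta> lp s) *s z"
    and dim_Vminus: "vec.dim (Vminus s) = card {i. s i = -1} - 1"
proof -
  show "z \<in> Vminus s \<Longrightarrow> Lk \<beta> lp lk s z = - of_real (gminus \<beta> lp s) *s z"
    using Lk_zero_sum_sign_class[of z s im] assms
    by (simp add: Vminus_eq_zero_sum_subspace gam_def)
  have "{i. s i = -1} \<noteq> {}"
    using assms(2) by blast
  then show "vec.dim (Vminus s) = card {i. s i = -1} - 1"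
    by (simp add: Vminus_eq_zero_sum_subspace[OF assms(1)] dim_zero_sum_subspace)
qed

definition sign_class_lift :: "('n::finite \<Rightarrow> real) \<Rightarrow> complex^2^'n" where
  "sign_class_lift s = (\<chi> i j. if (s i = 1) = (j = 1) then 1 else 0)"

lemma sign_class_lift_apply:
  "(sign_class_lift s *v w) $ i = (if s i = 1 then w$1 else w$2)"
  by (simp add: sign_class_lift_def matrix_vector_mult_def sum_2)

lemma range_sign_class_lift:
  assumes "\<forall>i. s i = 1 \<or> s i = -1" and "s ip = 1" and "s im = -1"
  shows "range ((*v) (sign_class_lift s)) = Vmean s"
proof
  show "range ((*v) (sign_class_lift s)) \<subseteq> Vmean s"
    by (auto simp: Vmean_def sign_class_lift_apply)
next
  show "Vmean s \<subseteq> range ((*v) (sign_class_lift s))"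
  proof
    fix z assume "z \<in> Vmean s"
    then have plus: "s i = 1 \<Longrightarrow> s j = 1 \<Longrightarrow> z$i = z$j"
      and minus: "s i = -1 \<Longrightarrow> s j = -1 \<Longrightarrow> z$i = z$j" for i j
      unfolding Vmean_def by blast+
    have "z$i = (if s i = 1 then z$ip else z$im)" for i
      using plus[of i ip] minus[of i im] assms by force
    then have "sign_class_lift s *v (\<chi> r. if r = 1 then z$ip else z$im) = z"
      by (simp add: vec_eq_iff sign_class_lift_apply)
    then show "z \<in> range ((*v) (sign_class_lift s))"
      by (metis rangeI)
  qed
qed

lemma inj_sign_class_lift:
  assumes "s ip = 1" and "s im = -1"
  shows "inj ((*v) (sign_class_lift s))"
proof (rule injI)
  fix x y assume eq: "sign_class_lift s *v x = sign_class_lift s *v y"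
  have "x$1 = y$1" "x$2 = y$2"
    using arg_cong[OF eq, of "\<lambda>v. v$ip"] arg_cong[OF eq, of "\<lambda>v. v$im"] assms
    by (simp_all add: sign_class_lift_apply)
  then show "x = y"
    by (simp add: vec_eq_iff forall_2)
qed

lemma sum_split_sign_classes:
  fixes s :: "'n::finite \<Rightarrow> real"
  assumes "\<forall>i. s i = 1 \<or> s i = -1"
  shows "(\<Sum>j\<in>UNIV. f j) = (\<Sum>j\<in>{j. s j = 1}. f j) + (\<Sum>j\<in>{j. s j = -1}. f j)"
proof -
  have "UNIV = {j. s j = 1} \<union> {j. s j = -1}" and "{j. s j = 1} \<inter> {j. s j = -1} = {}"
    using assms by auto
  then show ?thesis
    by (metis finite sum.union_disjoint)
qed

lemma Lk_sign_class_lift: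
  assumes "\<forall>i. s i = 1 \<or> s i = -1"
  shows "Lk \<beta> lp lk s (sign_class_lift s *v w) = sign_class_lift s *v (Bk \<beta> lp lk s *v w)"
proof -
  have coupling: "(\<Sum>j\<in>UNIV. of_real (Kstar \<beta> lp s i j) * (sign_class_lift s *v w)$j)
     = of_real (nplus s * (if s i = 1 then aplus \<beta> lp s else bminus \<beta> lp s)) * w$1
     + of_real (nminus s * (if s i = 1 then bplus \<beta> lp s else aminus \<beta> lp s)) * w$2" for i
    by (simp add: sum_split_sign_classes[OF assms] sign_class_lift_apply Kstar_def
        nplus_def nminus_def)
  have Bk_apply: "(Bk \<beta> lp lk s *v w) $ r = Bk \<beta> lp lk s $ r $ 1 * w$1 + Bk \<beta> lp lk s $ r $ 2 * w$2" for r
    by (simp add: matrix_vector_mult_def sum_2)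
  show ?thesis
  proof (rule vec_eq_iff[THEN iffD2], rule allI)
    fix i
    have "Lk \<beta> lp lk s (sign_class_lift s *v w) $ i
      = - of_real (gam \<beta> lp s i) * (sign_class_lift s *v w) $ i
        + of_real lk * (\<Sum>j\<in>UNIV. of_real (Kstar \<beta> lp s i j) * (sign_class_lift s *v w)$j)"
      by (simp add: Lk_def)
    also have "\<dots> = (sign_class_lift s *v (Bk \<beta> lp lk s *v w)) $ i"
      unfolding coupling unfolding sign_class_lift_apply Bk_apply
      by (simp add: gam_def Bk_def algebra_simps)
    finally show "Lk \<beta> lp lk s (sign_class_lift s *v w) $ i = (sign_class_lift s *v (Bk \<beta> lp lk s *v w)) $ i" .
  qed
qed

theorem propositionA3:
  fixes \<beta> lp lk :: real and s :: "'n::finite \<Rightarrow> real"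
  assumes "\<beta> > 0"
    and "\<forall>i. s i = 1 \<or> s i = -1"
    and "\<exists>i j. s i \<noteq> s j"
  shows "(\<forall>\<mu>. eigenvalue_on (Lk \<beta> lp lk s) (Vplus s) \<mu> \<longrightarrow> \<mu> = - of_real (gplus \<beta> lp s))
       \<and> alg_mult_on (Lk \<beta> lp lk s) (Vplus s) (- of_real (gplus \<beta> lp s)) = card {i. s i = 1} - 1
       \<and> (\<forall>\<mu>. eigenvalue_on (Lk \<beta> lp lk s) (Vminus s) \<mu> \<longrightarrow> \<mu> = - of_real (gminus \<beta> lp s))
       \<and> alg_mult_on (Lk \<beta> lp lk s) (Vminus s) (- of_real (gminus \<beta> lp s)) = card {i. s i = -1} - 1
       \<and> (\<forall>\<mu>. eigenvalue_on (Lk \<beta> lp lk s) (Vmean s) \<mu> \<longleftrightarrow> eigenvalue_on ((*v) (Bk \<beta> lp lk s)) UNIV \<mu>)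
       \<and> (\<forall>\<mu>. alg_mult_on (Lk \<beta> lp lk s) (Vmean s) \<mu> = alg_mult_on ((*v) (Bk \<beta> lp lk s)) UNIV \<mu>)"
proof -
  note sign = assms(2)
  obtain ip im where ip: "s ip = 1" and im: "s im = -1"
    using assms(2,3) by metis
  have "\<mu> = - of_real (gplus \<beta> lp s)" if "eigenvalue_on (Lk \<beta> lp lk s) (Vplus s) \<mu>" for \<mu>
    using Lk_Vplus[OF sign ip] that by (rule eigenvalue_on_scalar_action)
  moreover have "\<mu> = - of_real (gminus \<beta> lp s)" if "eigenvalue_on (Lk \<beta> lp lk s) (Vminus s) \<mu>" for \<mu>
    using Lk_Vminus[OF sign im] that by (rule eigenvalue_on_scalar_action)
  moreover have "alg_mult_on (Lk \<beta> lp lk s) (Vplus s) (- of_real (gplus \<beta> lp s)) = vec.dim (Vplus s)"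
    using Lk_Vplus[OF sign ip] by (rule alg_mult_on_scalar_action)
  moreover have "alg_mult_on (Lk \<beta> lp lk s) (Vminus s) (- of_real (gminus \<beta> lp s)) = vec.dim (Vminus s)"
    using Lk_Vminus[OF sign im] by (rule alg_mult_on_scalar_action)
  moreover have "eigenvalue_on (Lk \<beta> lp lk s) (Vmean s) \<mu> \<longleftrightarrow> eigenvalue_on ((*v) (Bk \<beta> lp lk s)) UNIV \<mu>"
    and "alg_mult_on (Lk \<beta> lp lk s) (Vmean s) \<mu> = alg_mult_on ((*v) (Bk \<beta> lp lk s)) UNIV \<mu>"
    for \<mu>
    unfolding range_sign_class_lift[OF sign ip im, symmetric]
    by (rule eigenvalue_on_range_intertwining alg_mult_on_range_intertwining;
        fact matrix_vector_mul_linear_gen inj_sign_class_lift[OF ip im] Lk_sign_class_lift[OF sign])+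
  ultimately show ?thesis
    unfolding dim_Vplus[OF sign ip] dim_Vminus[OF sign im] by blast
qed

end
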